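(* If $r>2$ is an integer, then there are no permutation polynomials of $\mathbb{F}_{3^r}$ of the form \[ f(x)=x^6+a_4x^4+a_3x^3+a_2x^2+a_1x \] with $a_1,a_2,a_3,a_4\in\mathbb{F}_{3^r}$.
   Context: A polynomial $f\in\mathbb{F}_q[x]$ is a permutation polynomial of $\mathbb{F}_q$ if $c\mapsto f(c)$ is a permutation of $\mathbb{F}_q$. *)

theory Defs
  imports "HOL-Computational_Algebra.Polynomial" "HOL-Library.Cardinality"
begin

definition permutation_polynomial :: "'a :: {field, finite} poly \<Rightarrow> bool" where
  "permutation_polynomial f \<longleftrightarrow> bij (poly f)"

end

theory Submission
  imports Defs
begin

text \<open>
  Let \<open>q = 3\<^sup>r\<close>. Comparing the coefficient of \<open>x\<^bsup>q-1\<^esup>\<close> in \<open>f\<^bsup>(q+3)/6\<^esup>\<close> (Hermite's criterion) gives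
  \<open>a2 = a4\<^sup>2\<close>, so \<open>f = L\<^sup>2 + b L + e x\<close> with the additive polynomial \<open>L = x\<^sup>3 - a4 x\<close>.
  If \<open>L\<close> were bijective, \<open>f(y + 1) = f(y)\<close> would be solvable for \<open>y\<close>; hence \<open>a4 = s\<^sup>2 \<noteq> 0\<close>, and after
  scaling by \<open>s\<close> additive Hilbert 90 turns injectivity of \<open>f\<close> into
  \<open>Tr (B + E / (z\<^sup>2 - 1)) \<noteq> 0\<close> for all \<open>z\<close> outside the prime field, with \<open>E \<noteq> 0\<close>. The values
  \<open>w = 1 / (z\<^sup>2 - 1)\<close> are those for which \<open>w\<^sup>2 + w\<close> is a nonzero square, so with \<open>t = - Tr B\<close> and \<open>\<eta>\<close> the
  quadratic character of \<open>w\<^sup>2 + w\<close>, the product \<open>(\<eta>\<^sup>2 + \<eta>) ((Tr (E w) - t)\<^sup>2 - 1)\<close> vanishes identically.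
  Since \<open>(1 + w)\<^bsup>(q-1)/2\<^esup>\<close> is the sum of the \<open>w\<^sup>k\<close> over those \<open>k\<close> with only digits 0 and 1 in base 3, the
  moments of \<open>\<eta>\<close> are explicit. The moments of order 5, 2 and 20, chosen so that almost all terms of the
  expanded trace have a digit 2, force \<open>E = Tr E = \<plusminus>1\<close> and then a contradiction (order 20 only if \<open>r > 3\<close>).
\<close>

subsection \<open>Power sums over finite fields\<close>

text \<open>The translation by 1 permutes the ring, so summing \<open>x + 1\<close> and
  \<open>x\<close> over it gives the same value.\<close>

lemma of_nat_card_UNIV: "of_nat CARD('a::{ring_1,finite}) = (0::'a)"
proof -
  have "(\<Sum>x\<in>UNIV. x + (1::'a)) = (\<Sum>x\<in>UNIV. x)"
    by (rule sum.reindex_bij_witness[of _ "\<lambda>x. x - 1" "\<lambda>x. x + 1"]) auto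
  then show ?thesis by (simp add: sum.distrib)
qed

lemma finite_field_power_card_minus_1:
  fixes x :: "'a::{field,finite}"
  assumes "x \<noteq> 0"
  shows "x ^ (CARD('a) - 1) = 1"
proof -
  have "(\<Prod>y\<in>-{0}. x * y) = (\<Prod>y\<in>-{0}. y)"
    by (rule prod.reindex_bij_witness[of _ "\<lambda>y. y / x" "\<lambda>y. x * y"]) (use assms in auto)
  then have "x ^ card (- {0::'a}) * \<Prod>(- {0}) = \<Prod>(- {0})"
    by (simp add: prod.distrib)
  moreover have "\<Prod>(- {0::'a}) \<noteq> 0" by simp
  moreover have "card (- {0::'a}) = CARD('a) - 1"
    by (simp add: Compl_eq_Diff_UNIV card_Diff_subset)
  ultimately show ?thesis by simp
qed

lemma finite_field_power_mod:
  fixes x :: "'a::{field,finite}"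
  assumes "x \<noteq> 0"
  shows "x ^ n = x ^ (n mod (CARD('a) - 1))"
proof -
  have "x ^ n = x ^ ((CARD('a) - 1) * (n div (CARD('a) - 1)) + n mod (CARD('a) - 1))"
    by simp
  also have "\<dots> = x ^ (n mod (CARD('a) - 1))"
    unfolding power_add power_mult by (simp only: finite_field_power_card_minus_1[OF assms] power_one mult_1_left)
  finally show ?thesis .
qed

lemma card_power_eq_1_le:
  assumes "k > 0"
  shows "card {x::'a::idom. x ^ k = 1} \<le> k"
proof -
  define p :: "'a poly" where "p = monom 1 k - 1"
  have "coeff p k = 1" using assms by (simp add: p_def)
  then have "p \<noteq> 0" by auto
  have "degree p \<le> k" unfolding p_def by (rule degree_diff_le) (auto simp: degree_monom_le)
  moreover have "{x. poly p x = 0} = {x. x ^ k = 1}"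
    by (auto simp: p_def poly_monom)
  ultimately show ?thesis using card_poly_roots_bound[OF \<open>p \<noteq> 0\<close>] by simp
qed

text \<open>When \<open>CARD('a) - 1\<close> does not divide \<open>n\<close>, let \<open>k\<close>
  be the residue of \<open>n\<close>. The at most \<open>k\<close> roots of \<open>x ^ k = 1\<close>
  cannot cover all nonzero elements, so some \<open>g\<close> has \<open>g ^ k \<noteq> 1\<close>.
  Substituting \<open>g * x\<close> multiplies the sum by \<open>g ^ k\<close>, which forces it to
  be 0.\<close>

lemma finite_field_sum_powers:
  "(\<Sum>x\<in>UNIV. (x::'a::{field,finite}) ^ n) = (if n > 0 \<and> (CARD('a) - 1) dvd n then -1 else 0)"
proof -
  consider "n = 0" | "n > 0" "(CARD('a) - 1) dvd n" | "\<not> (CARD('a) - 1) dvd n" by auto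
  then show ?thesis
  proof cases
    case 1
    then show ?thesis by (simp add: of_nat_card_UNIV)
  next
    case 2
    have *: "x ^ n = 1 - (if x = 0 then 1 else 0)" for x :: 'a
      using 2 finite_field_power_mod[of x n] by (auto simp: power_0_left)
    have "(\<Sum>x\<in>UNIV. (x::'a) ^ n) = (\<Sum>x\<in>UNIV. 1 - (if (x::'a) = 0 then 1 else 0))"
      by (rule sum.cong[OF refl *])
    also have "\<dots> = -1"
      unfolding sum_subtractf by (simp add: of_nat_card_UNIV)
    finally show ?thesis using 2 by simp
  next
    case 3
    define k where "k = n mod (CARD('a) - 1)"
    have k: "k > 0" using 3 by (simp add: k_def mod_greater_zero_iff_not_dvd)
    have c: "card (- {0::'a}) = CARD('a) - 1"
      by (simp add: Compl_eq_Diff_UNIV card_Diff_subset)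
    have "CARD('a) - 1 > 0" 
    proof -
      have "card {0, 1::'a} \<le> CARD('a)" by (rule card_mono) auto
      then show ?thesis by simp
    qed
    then have "k < CARD('a) - 1" by (simp add: k_def)
    have "\<not> - {0::'a} \<subseteq> {x. x ^ k = 1}"
      using card_mono[of "{x::'a. x ^ k = 1}" "- {0}"] card_power_eq_1_le[OF k, where 'a='a]
        \<open>k < _\<close> c by (auto simp del: Compl_subset_Compl_iff)
    then obtain g :: 'a where g: "g \<noteq> 0" "g ^ k \<noteq> 1" by auto
    have "(\<Sum>x\<in>UNIV. (g * x) ^ n) = (\<Sum>x\<in>UNIV. x ^ n)"
      by (rule sum.reindex_bij_witness[of _ "\<lambda>y. y / g" "\<lambda>y. g * y"]) (use g in auto)
    then have "g ^ k * (\<Sum>x\<in>UNIV. x ^ n) = (\<Sum>x\<in>UNIV. x ^ n)"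
      using g finite_field_power_mod[of g n]
      by (simp add: power_mult_distrib sum_distrib_left k_def)
    then have "(\<Sum>x\<in>UNIV. (x::'a) ^ n) = 0" using g(2) by simp
    then show ?thesis using 3 by simp
  qed
qed

text \<open>The degree bound leaves \<open>CARD('a) - 1\<close> as the only positive multiple of
  itself among the exponents. This is the form in which Hermite's criterion reads off a
  coefficient.\<close>

lemma finite_field_sum_poly:
  fixes p :: "'a::{field,finite} poly"
  assumes "degree p < 2 * (CARD('a) - 1)"
  shows "(\<Sum>x\<in>UNIV. poly p x) = - coeff p (CARD('a) - 1)"
proof -
  let ?q = "CARD('a) - 1"
  have "?q > 0" using assms by simp
  have *: "n = ?q" if "n > 0" "?q dvd n" "n \<le> degree p" for n
  proof -
    obtain c where c: "n = ?q * c" using \<open>?q dvd n\<close> by blast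
    with that(3) assms have "?q * c < ?q * 2" by linarith
    then have "c < 2" by simp
    with c that(1) show ?thesis by (cases "c = 0"; cases "c = 1") auto
  qed
  have "(\<Sum>x\<in>UNIV. poly p x) = (\<Sum>x\<in>UNIV. \<Sum>i\<le>degree p. coeff p i * x ^ i)"
    by (simp add: poly_altdef)
  also have "\<dots> = (\<Sum>i\<le>degree p. coeff p i * (\<Sum>x\<in>UNIV. x ^ i))"
    by (subst sum.swap) (simp add: sum_distrib_left)
  also have "\<dots> = (\<Sum>i\<le>degree p. if i = ?q then - coeff p i else 0)"
    unfolding finite_field_sum_powers using * \<open>?q > 0\<close> by (intro sum.cong) auto
  also have "\<dots> = - coeff p ?q"
    by (auto simp: coeff_eq_0)
  finally show ?thesis .
qed

lemma finite_field_sum_power_quotient: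
  fixes k j :: nat
  assumes "k < CARD('a::{field,finite}) - 1" "j < CARD('a) - 1"
  shows "(\<Sum>x\<in>-{0}. (x::'a) ^ k / x ^ j) = (if k = j then -1 else 0)"
proof -
  \<comment> \<open>The exponent \<open>k - j\<close> is shifted by \<open>CARD('a) - 1\<close> to
    stay a natural number; it is strictly positive, so adding the term at 0 later changes
    nothing.\<close>
  define n where "n = k + (CARD('a) - 1 - j)"
  have n: "n > 0" using assms by (simp add: n_def)
  have eq: "x ^ k / x ^ j = x ^ n" if "x \<noteq> 0" for x :: 'a
  proof -
    have "x ^ n * x ^ j = x ^ k * x ^ (CARD('a) - 1)"
      using assms(2) by (simp add: n_def flip: power_add)
    then show ?thesis
      using that finite_field_power_card_minus_1[OF that] by (simp add: field_simps)
  qed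
  have dvd: "(CARD('a) - 1) dvd n \<longleftrightarrow> k = j"
  proof
    assume "(CARD('a) - 1) dvd n"
    then obtain c where c: "n = (CARD('a) - 1) * c" by blast
    have "(CARD('a) - 1) * c < (CARD('a) - 1) * 2"
      unfolding c[symmetric] using assms by (simp add: n_def)
    then have "c < 2" by simp
    moreover have "c \<noteq> 0" using c n by auto
    ultimately have "c = 1" by simp
    then show "k = j" using c assms unfolding n_def by simp
  qed (use assms in \<open>simp add: n_def\<close>)
  have "(\<Sum>x\<in>-{0}. (x::'a) ^ k / x ^ j) = (\<Sum>x\<in>-{0}. x ^ n)"
    by (intro sum.cong) (auto simp: eq)
  also have "\<dots> = (\<Sum>x\<in>UNIV. x ^ n)"
    using n by (intro sum.mono_neutral_left) (auto simp: power_0_left)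
  finally show ?thesis using n dvd by (simp add: finite_field_sum_powers)
qed

lemma card_le_mult_card_image:
  assumes "finite A" "\<And>y. y \<in> f ` A \<Longrightarrow> card {x \<in> A. f x = y} \<le> k"
  shows "card A \<le> k * card (f ` A)"
proof -
  have "card A = (\<Sum>y\<in>f ` A. card {x \<in> A. f x = y})"
    using sum.image_gen[OF assms(1), of "\<lambda>_. 1::nat" f] by simp
  also have "\<dots> \<le> (\<Sum>y\<in>f ` A. k)" by (intro sum_mono assms(2))
  finally show ?thesis by (simp add: mult.commute)
qed

text \<open>Euler's criterion by counting: squaring is at most two-to-one on the
  \<open>2 * m\<close> nonzero elements, so there are at least \<open>m\<close> nonzero squares.
  They all lie among the at most \<open>m\<close> roots of \<open>x ^ m = 1\<close>, hence exhaust
  them.\<close>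

lemma finite_field_square_if_power_eq_1:
  fixes y :: "'a::{field,finite}"
  assumes m: "CARD('a) = 2 * m + 1" and "y ^ m = 1"
  shows "\<exists>c. c \<noteq> 0 \<and> y = c ^ 2"
proof -
  have "CARD('a) > 1"
  proof -
    have "card {0, 1::'a} \<le> CARD('a)" by (rule card_mono) auto
    then show ?thesis by simp
  qed
  then have "m > 0" using m by simp
  let ?A = "- {0::'a}" and ?R = "{x::'a. x ^ m = 1}"
  have "card ?A \<le> 2 * card ((\<lambda>x. x ^ 2) ` ?A)"
  proof (rule card_le_mult_card_image)
    fix y assume "y \<in> (\<lambda>x. x ^ 2) ` ?A"
    then obtain c where "y = c ^ 2" by auto
    then have "{x \<in> ?A. x ^ 2 = y} \<subseteq> {c, - c}" by (auto simp: power2_eq_iff)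
    then have "card {x \<in> ?A. x ^ 2 = y} \<le> card {c, - c}" by (intro card_mono) auto
    also have "\<dots> \<le> 2" by (simp add: card_insert_if)
    finally show "card {x \<in> ?A. x ^ 2 = y} \<le> 2" .
  qed auto
  moreover have "card ?A = 2 * m"
    using m by (simp add: Compl_eq_Diff_UNIV card_Diff_subset)
  ultimately have "m \<le> card ((\<lambda>x. x ^ 2) ` ?A)" by simp
  moreover have "(\<lambda>x. x ^ 2) ` ?A \<subseteq> ?R"
    using finite_field_power_card_minus_1[where 'a='a] m by (auto simp flip: power_mult)
  moreover have "card ?R \<le> m" using card_power_eq_1_le[OF \<open>m > 0\<close>] .
  ultimately have "(\<lambda>x. x ^ 2) ` ?A = ?R"
    by (intro card_seteq) auto
  then have "y \<in> (\<lambda>x. x ^ 2) ` ?A" using assms(2) by simp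
  then show ?thesis by auto
qed

subsection \<open>The absolute trace in characteristic 3\<close>

lemma char3_cube_add:
  fixes x y :: "'a::comm_ring_1"
  assumes "(3::'a) = 0"
  shows "(x + y) ^ 3 = x ^ 3 + y ^ 3"
proof -
  have "(x + y) ^ 3 = x ^ 3 + y ^ 3 + 3 * (x ^ 2 * y + x * y ^ 2)"
    by (simp add: power3_eq_cube power2_eq_square algebra_simps)
  then show ?thesis using assms by simp
qed

lemma char3_cube_sum:
  fixes g :: "'b \<Rightarrow> 'a::comm_ring_1"
  assumes "(3::'a) = 0"
  shows "(\<Sum>i\<in>I. g i) ^ 3 = (\<Sum>i\<in>I. g i ^ 3)"
  by (induction I rule: infinite_finite_induct) (simp_all add: char3_cube_add[OF assms])

lemma card_3_power_imp_char3:
  assumes "CARD('a::{field,finite}) = 3 ^ r"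
  shows "(3::'a) = 0"
  using of_nat_card_UNIV[where 'a='a] assms by simp

lemma finite_field_power_card:
  fixes x :: "'a::{field,finite}"
  shows "x ^ CARD('a) = x"
proof (cases "x = 0")
  case False
  have "x ^ CARD('a) = x * x ^ (CARD('a) - 1)"
    by (simp flip: power_Suc)
  then show ?thesis using False finite_field_power_card_minus_1[of x] by simp
qed simp

text \<open>The absolute trace down to the prime field, kept with values in \<open>'a\<close> so
  that it can be expanded as a sum of powers; \<open>trace3_cube\<close> records that the values are
  fixed by cubing.\<close>

definition trace3 :: "nat \<Rightarrow> 'a::field \<Rightarrow> 'a" where
  "trace3 r x = (\<Sum>i<r. x ^ 3 ^ i)"

lemma char3_pow3_add:
  fixes x y :: "'a::comm_ring_1"
  assumes "(3::'a) = 0"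
  shows "(x + y) ^ 3 ^ i = x ^ 3 ^ i + y ^ 3 ^ i"
  by (induction i) (simp_all add: power_mult char3_cube_add[OF assms] mult.commute[of 3])

lemma trace3_add:
  fixes x y :: "'a::field"
  assumes "(3::'a) = 0"
  shows "trace3 r (x + y) = trace3 r x + trace3 r y"
  by (simp add: trace3_def char3_pow3_add[OF assms] sum.distrib)

lemma trace3_minus: "trace3 r (- x) = - trace3 r x"
  by (simp add: trace3_def sum_negf power_minus_odd)

text \<open>Cubing shifts the conjugates cyclically, since \<open>x ^ 3 ^ r = x\<close>.\<close>

lemma trace3_cube:
  fixes x :: "'a::{field,finite}"
  assumes q: "CARD('a) = 3 ^ r"
  shows "trace3 r x ^ 3 = trace3 r x" "trace3 r (x ^ 3) = trace3 r x"
proof -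
  have "(\<Sum>i<r. x ^ 3 ^ Suc i) + x ^ 3 ^ 0 = (\<Sum>i<Suc r. x ^ 3 ^ i)"
    by (subst sum.lessThan_Suc_shift) simp
  also have "\<dots> = trace3 r x + x"
    using finite_field_power_card[of x] q by (simp add: trace3_def)
  finally have *: "(\<Sum>i<r. x ^ 3 ^ Suc i) = trace3 r x" by simp
  then show "trace3 r (x ^ 3) = trace3 r x"
    by (simp add: trace3_def power_mult[symmetric])
  show "trace3 r x ^ 3 = trace3 r x"
    using * char3_cube_sum[OF card_3_power_imp_char3[OF q], of "\<lambda>i. x ^ 3 ^ i" "{..<r}"]
    by (simp add: trace3_def power_mult[symmetric] mult.commute)
qed

text \<open>Additive Hilbert 90 by counting: the fibres of \<open>y ^ 3 - y\<close> are translates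
  of the roots 0, 1, -1 of \<open>d ^ 3 - d\<close>, so its range has at least
  \<open>3 ^ (r - 1)\<close> elements. The range lies in the trace kernel, the root set of a nonzero
  polynomial of degree at most \<open>3 ^ (r - 1)\<close>, so the two coincide.\<close>

lemma trace3_eq_0_imp:
  fixes c :: "'a::{field,finite}"
  assumes q: "CARD('a) = 3 ^ r" and "r > 0" and "trace3 r c = 0"
  shows "\<exists>y. y ^ 3 - y = c"
proof -
  note c3 = card_3_power_imp_char3[OF q]
  obtain k where r: "r = Suc k" using \<open>r > 0\<close> by (cases r) auto
  let ?h = "\<lambda>y::'a. y ^ 3 - y" and ?K = "{x::'a. trace3 r x = 0}"
  have "CARD('a) \<le> 3 * card (range ?h)"
  proof (rule card_le_mult_card_image)
    fix z assume "z \<in> range ?h"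
    then obtain y0 where z: "z = y0 ^ 3 - y0" by auto
    have "{y \<in> UNIV. ?h y = z} \<subseteq> {y0, y0 + 1, y0 - 1}"
    proof
      fix y assume "y \<in> {y \<in> UNIV. ?h y = z}"
      then have "y ^ 3 - y = y0 ^ 3 - y0" using z by simp
      moreover have "y ^ 3 = (y - y0) ^ 3 + y0 ^ 3"
        using char3_cube_add[OF c3, of "y - y0" y0] by simp
      ultimately have "(y - y0) ^ 3 - (y - y0) = 0" by (simp add: algebra_simps)
      moreover have "d ^ 3 - d = d * (d - 1) * (d + 1)" for d :: 'a
        by (simp add: algebra_simps power3_eq_cube)
      ultimately have "(y - y0) * (y - y0 - 1) * (y - y0 + 1) = 0" by simp
      then have "y - y0 = 0 \<or> y - y0 = 1 \<or> y - y0 = -1"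
        by (simp only: mult_eq_0_iff eq_neg_iff_add_eq_0 eq_iff_diff_eq_0[of "y - y0" 1] disj_assoc)
      moreover have "y = y0 + (y - y0)" by simp
      ultimately show "y \<in> {y0, y0 + 1, y0 - 1}" by (metis add.right_neutral insertCI uminus_add_conv_diff add.commute)
    qed
    then have "card {y \<in> UNIV. ?h y = z} \<le> card {y0, y0 + 1, y0 - 1}"
      by (intro card_mono) auto
    also have "\<dots> \<le> 3" by (simp add: card_insert_if)
    finally show "card {y \<in> UNIV. ?h y = z} \<le> 3" .
  qed auto
  then have "3 ^ k \<le> card (range ?h)" using q r by simp
  moreover have "range ?h \<subseteq> ?K"
    using trace3_add[OF c3, of r "_ ^ 3" "- _"] trace3_cube[OF q]
    by (auto simp: trace3_minus)
  moreover have "card ?K \<le> 3 ^ k"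
  proof -
    define p :: "'a poly" where "p = (\<Sum>i<r. monom 1 (3 ^ i))"
    have "coeff p (3 ^ k) = (\<Sum>i<r. if i = k then 1 else 0)"
      unfolding p_def coeff_sum by (intro sum.cong) (auto simp: power_inject_exp)
    then have "p \<noteq> 0" using r by auto
    have "degree p \<le> 3 ^ k" unfolding p_def
    proof (intro degree_sum_le)
      fix i assume "i \<in> {..<r}"
      then have "(3::nat) ^ i \<le> 3 ^ k" using r by (intro power_increasing) auto
      then show "degree (monom 1 (3 ^ i) :: 'a poly) \<le> 3 ^ k"
        using degree_monom_le[of "1::'a" "3 ^ i"] by linarith
    qed auto
    moreover have "{x. poly p x = 0} = ?K"
      by (simp add: p_def poly_sum poly_monom trace3_def)
    ultimately show ?thesis using card_poly_roots_bound[OF \<open>p \<noteq> 0\<close>] by simp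
  qed
  ultimately have "range ?h = ?K" by (intro card_seteq) auto
  then have "c \<in> range ?h" using assms(3) by simp
  then show ?thesis by auto
qed

subsection \<open>Ternary digits and moments of the quadratic character\<close>

text \<open>By Lucas' theorem, for \<open>k < 3 ^ r\<close> these are the \<open>k\<close> whose
  binomial coefficient under \<open>(3 ^ r - 1) div 2\<close>, written with \<open>r\<close> digits
  1 in base 3, is nonzero modulo 3; that coefficient is then 1.\<close>

function zero_one_ternary :: "nat \<Rightarrow> bool" where
  "zero_one_ternary n = (if n = 0 then True else n mod 3 \<noteq> 2 \<and> zero_one_ternary (n div 3))"
  by auto
termination by (relation "measure id") auto

declare zero_one_ternary.simps [simp del]

lemmas zero_one_ternary_numeral =
  zero_one_ternary.simps[of 0] zero_one_ternary.simps[of "Suc 0"]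
  zero_one_ternary.simps[of "numeral k" for k]

lemma zero_one_ternary_mult_add:
  "zero_one_ternary (3 * n) \<longleftrightarrow> zero_one_ternary n"
  "zero_one_ternary (3 * n + 1) \<longleftrightarrow> zero_one_ternary n"
  "\<not> zero_one_ternary (3 * n + 2)"
proof -
  have "(3 * n + 1) mod 3 = 1" "(3 * n + 2) mod 3 = 2" "(3 * n + 1) div 3 = n" by presburger+
  then show "zero_one_ternary (3 * n) \<longleftrightarrow> zero_one_ternary n"
    "zero_one_ternary (3 * n + 1) \<longleftrightarrow> zero_one_ternary n" "\<not> zero_one_ternary (3 * n + 2)"
    using zero_one_ternary.simps[of "3 * n"] zero_one_ternary.simps[of 0]
      zero_one_ternary.simps[of "3 * n + 1"] zero_one_ternary.simps[of "3 * n + 2"]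
    by (cases "n = 0"; simp)+
qed

text \<open>A final digit 2 survives unless some added power is 1. After that carry, 3 plus a
  further power is bad only if the power is 3 itself, which makes 6, or 20 in base 3.\<close>

lemma zero_one_ternary_2_plus:
  "zero_one_ternary (2 + 3 ^ i) \<longleftrightarrow> i = 0"
  "zero_one_ternary (2 + 3 ^ i + 3 ^ j) \<longleftrightarrow> i = 0 \<and> j = 0 \<or> i = 0 \<and> 2 \<le> j \<or> 2 \<le> i \<and> j = 0"
proof -
  have *: "zero_one_ternary (3 + 3 ^ Suc k) \<longleftrightarrow> k \<noteq> 0" for k
  proof (cases k)
    case (Suc l)
    have "3 + 3 ^ Suc k = 3 * (3 * 3 ^ l + (1::nat))" by (simp add: Suc)
    then have "zero_one_ternary (3 + 3 ^ Suc k) \<longleftrightarrow> zero_one_ternary (3 ^ l)"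
      by (simp only: zero_one_ternary_mult_add)
    moreover have "zero_one_ternary (3 ^ l)"
      by (induction l) (simp_all add: zero_one_ternary_mult_add zero_one_ternary_numeral)
    ultimately show ?thesis by (simp add: Suc)
  qed (simp add: zero_one_ternary_numeral)
  have Suc3: "Suc (Suc (Suc (3 * n))) = 3 + 3 * n" for n by simp
  show "zero_one_ternary (2 + 3 ^ i) \<longleftrightarrow> i = 0"
    using zero_one_ternary_mult_add(3)[of "3 ^ (i - 1)"]
    by (cases i) (auto simp: zero_one_ternary_numeral)
  show "zero_one_ternary (2 + 3 ^ i + 3 ^ j) \<longleftrightarrow> i = 0 \<and> j = 0 \<or> i = 0 \<and> 2 \<le> j \<or> 2 \<le> i \<and> j = 0"
    using zero_one_ternary_mult_add(3)[of "3 ^ (i - 1) + 3 ^ (j - 1)"] *[of "i - 1"] *[of "j - 1"]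
    by (cases i; cases j) (auto simp: zero_one_ternary_numeral add.assoc Suc3)
qed

text \<open>In base 3, 5 is 12: adding 1 carries to 20, and only a further 3 clears the remaining 2,
  giving 100.\<close>

lemma zero_one_ternary_5_plus:
  "\<not> zero_one_ternary (5 + 3 ^ i)"
  "zero_one_ternary (5 + 3 ^ i + 3 ^ j) \<longleftrightarrow> i = 0 \<and> j = 1 \<or> i = 1 \<and> j = 0"
proof -
  have *: "zero_one_ternary (6 + 3 ^ Suc k) \<longleftrightarrow> k = 0" for k
    using zero_one_ternary_mult_add(1)[of "2 + 3 ^ k"] unfolding zero_one_ternary_2_plus by simp
  show "\<not> zero_one_ternary (5 + 3 ^ i)"
    using zero_one_ternary_mult_add(3)[of "1 + 3 ^ (i - 1)"]
    by (cases i) (auto simp: zero_one_ternary_numeral)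
  show "zero_one_ternary (5 + 3 ^ i + 3 ^ j) \<longleftrightarrow> i = 0 \<and> j = 1 \<or> i = 1 \<and> j = 0"
    using zero_one_ternary_mult_add(3)[of "1 + 3 ^ (i - 1) + 3 ^ (j - 1)"] *[of "i - 1"] *[of "j - 1"]
    by (cases i; cases j) (auto simp: zero_one_ternary_numeral add.assoc)
qed

text \<open>In base 3, 20 is 202: adding 1 gives 210, and only a further 9 removes the leading 2,
  giving 1010.\<close>

lemma zero_one_ternary_20_plus:
  "\<not> zero_one_ternary (20 + 3 ^ i)"
  "zero_one_ternary (20 + 3 ^ i + 3 ^ j) \<longleftrightarrow> i = 0 \<and> j = 2 \<or> i = 2 \<and> j = 0"
proof -
  have *: "zero_one_ternary (21 + 3 ^ Suc k) \<longleftrightarrow> k = 1" for k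
  proof (cases k)
    case (Suc l)
    have "21 + 3 ^ Suc k = 3 * (3 * (2 + 3 ^ l) + (1::nat))" by (simp add: Suc)
    then show ?thesis
      by (simp only: zero_one_ternary_mult_add zero_one_ternary_2_plus Suc) simp
  qed (simp add: zero_one_ternary_numeral)
  show "\<not> zero_one_ternary (20 + 3 ^ i)"
    using zero_one_ternary_mult_add(3)[of "6 + 3 ^ (i - 1)"]
    by (cases i) (auto simp: zero_one_ternary_numeral)
  show "zero_one_ternary (20 + 3 ^ i + 3 ^ j) \<longleftrightarrow> i = 0 \<and> j = 2 \<or> i = 2 \<and> j = 0"
    using zero_one_ternary_mult_add(3)[of "6 + 3 ^ (i - 1) + 3 ^ (j - 1)"] *[of "i - 1"] *[of "j - 1"]
    by (cases i; cases j) (auto simp: zero_one_ternary_numeral add.assoc)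
qed

text \<open>The exponent for \<open>Suc r\<close> is three times that for \<open>r\<close> plus 1,
  so Frobenius applied to the induction hypothesis and one factor \<open>1 + w\<close> append a last
  digit 0 or 1 to each admissible exponent.\<close>

lemma one_plus_power_half:
  fixes w :: "'a::comm_ring_1"
  assumes c3: "(3::'a) = 0"
  shows "(1 + w) ^ ((3 ^ r - 1) div 2) = (\<Sum>k<3 ^ r. of_bool (zero_one_ternary k) * w ^ k)"
proof (induction r arbitrary: w)
  case 0
  then show ?case by (simp add: zero_one_ternary.simps)
next
  case (Suc r)
  have "odd ((3::nat) ^ r)" by simp
  then have e: "((3::nat) ^ Suc r - 1) div 2 = 3 * ((3 ^ r - 1) div 2) + 1"
    by (elim oddE) simp
  have "(1 + w) ^ ((3 ^ Suc r - 1) div 2) = (1 + w ^ 3) ^ ((3 ^ r - 1) div 2) * (1 + w)"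
    unfolding e power_add power_mult by (simp add: char3_cube_add[OF c3])
  also have "\<dots> = (\<Sum>k<3 ^ r. of_bool (zero_one_ternary k) * (w ^ (3 * k) + w ^ (3 * k + 1)))"
    unfolding Suc.IH sum_distrib_right
    by (intro sum.cong refl) (simp add: algebra_simps flip: power_mult)
  also have "\<dots> = (\<Sum>k<3 ^ r. \<Sum>n\<in>{k * 3..<k * 3 + 3}. of_bool (zero_one_ternary n) * w ^ n)"
  proof (intro sum.cong refl)
    fix k :: nat
    have "{k * 3..<k * 3 + 3} = {3 * k, 3 * k + 1, 3 * k + 2}" by auto
    then show "of_bool (zero_one_ternary k) * (w ^ (3 * k) + w ^ (3 * k + 1)) =
      (\<Sum>n\<in>{k * 3..<k * 3 + 3}. of_bool (zero_one_ternary n) * w ^ n)"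
      by (simp add: zero_one_ternary_mult_add[simplified] distrib_left)
  qed
  also have "\<dots> = (\<Sum>k<3 ^ Suc r. of_bool (zero_one_ternary k) * w ^ k)"
    unfolding sum.nat_group by (simp only: power_Suc mult.commute)
  finally show ?case .
qed

text \<open>For \<open>w \<noteq> 0\<close> one has \<open>w ^ 2 + w = w ^ 2 * (1 + 1 / w)\<close>,
  so the character equals \<open>(1 + 1 / w) ^ m\<close>. Its expansion in powers of
  \<open>1 / w\<close> is explicit, and orthogonality of powers picks out the term
  \<open>j = k\<close>.\<close>

lemma sum_powers_quadratic_character:
  assumes q: "CARD('a::{field,finite}) = 3 ^ r" and m: "m = (3 ^ r - 1) div 2" and "k < 3 ^ r - 1"
  shows "(\<Sum>w\<in>UNIV. (w ^ 2 + w) ^ m * (w::'a) ^ k) = - of_bool (zero_one_ternary k)"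
proof -
  note c3 = card_3_power_imp_char3[OF q]
  have r: "r > 0" using \<open>k < _\<close> by (cases r) auto
  have m2: "2 * m = CARD('a) - 1" using m q by simp
  have "m > 0" using m2 \<open>k < _\<close> q by simp
  have eta: "(w ^ 2 + w) ^ m = (\<Sum>j<3 ^ r. of_bool (zero_one_ternary j) / w ^ j)" if "w \<noteq> 0" for w :: 'a
  proof -
    have "(w ^ 2 + w) = w ^ 2 * (1 + 1 / w)"
      using that by (simp add: power2_eq_square field_simps)
    then have "(w ^ 2 + w) ^ m = w ^ (2 * m) * (1 + 1 / w) ^ m"
      by (simp add: power_mult_distrib power_mult)
    also have "w ^ (2 * m) = 1" unfolding m2 by (rule finite_field_power_card_minus_1[OF that])
    also have "1 * (1 + 1 / w) ^ m = (\<Sum>j<3 ^ r. of_bool (zero_one_ternary j) / w ^ j)"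
      unfolding m one_plus_power_half[OF c3] by (simp add: power_divide)
    finally show ?thesis .
  qed
  \<comment> \<open>The index \<open>3 ^ r - 1\<close> lies just outside the orthogonality range; it
    drops out because its digits are all 2.\<close>
  have last: "\<not> zero_one_ternary (3 ^ r - 1)"
  proof -
    have "(3::nat) ^ r = 3 * 3 ^ (r - 1)" using r by (cases r) auto
    moreover have "(3::nat) ^ (r - 1) > 0" by simp
    ultimately have "(3::nat) ^ r - 1 = 3 * (3 ^ (r - 1) - 1) + 2" by linarith
    then show ?thesis using zero_one_ternary_mult_add(3) by simp
  qed
  have "(\<Sum>w\<in>UNIV. (w ^ 2 + w) ^ m * (w::'a) ^ k) = (\<Sum>w\<in>-{0}. (w ^ 2 + w) ^ m * (w::'a) ^ k)"
    using \<open>m > 0\<close> by (intro sum.mono_neutral_right) auto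
  also have "\<dots> = (\<Sum>w\<in>-{0}. \<Sum>j<3 ^ r. of_bool (zero_one_ternary j) * (w ^ k / w ^ j))"
    by (intro sum.cong refl) (simp add: eta sum_distrib_right)
  also have "\<dots> = (\<Sum>j<3 ^ r. of_bool (zero_one_ternary j) * (\<Sum>w\<in>-{0}. (w::'a) ^ k / w ^ j))"
    by (subst sum.swap) (simp add: sum_distrib_left)
  also have "\<dots> = (\<Sum>j<3 ^ r. if j = k then - of_bool (zero_one_ternary j) else (0::'a))"
  proof (intro sum.cong refl)
    fix j assume "j \<in> {..<(3::nat) ^ r}"
    then have "j = 3 ^ r - 1 \<or> j < CARD('a) - 1" using q by auto
    then show "of_bool (zero_one_ternary j) * (\<Sum>w\<in>-{0}. (w::'a) ^ k / w ^ j) =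
      (if j = k then - of_bool (zero_one_ternary j) else 0)"
      using last finite_field_sum_power_quotient[of k j, where 'a='a] \<open>k < _\<close> q by auto
  qed
  also have "\<dots> = - of_bool (zero_one_ternary k)" using less_imp_diff_less[OF \<open>k < _\<close>, of 0] by auto
  finally show ?thesis .
qed

section \<open>Moments of the trace condition\<close>

lemma sum_weighted_trace_square:
  fixes \<phi> :: "'a::{field,finite} \<Rightarrow> 'a"
  defines "M \<equiv> \<lambda>n. \<Sum>w\<in>UNIV. \<phi> w * w ^ n"
  shows "(\<Sum>w\<in>UNIV. \<phi> w * w ^ a * ((trace3 r (E * w) - t) ^ 2 - 1)) =
    (\<Sum>i<r. \<Sum>j<r. E ^ 3 ^ i * E ^ 3 ^ j * M (a + 3 ^ i + 3 ^ j))
    - 2 * t * (\<Sum>i<r. E ^ 3 ^ i * M (a + 3 ^ i)) + (t ^ 2 - 1) * M a"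
proof -
  have 1: "(\<Sum>w\<in>UNIV. \<phi> w * w ^ a * trace3 r (E * w)) = (\<Sum>i<r. E ^ 3 ^ i * M (a + 3 ^ i))"
    unfolding trace3_def M_def sum_distrib_left
    by (subst sum.swap) (simp add: power_mult_distrib power_add mult_ac)
  have 2: "(\<Sum>w\<in>UNIV. \<phi> w * w ^ a * (trace3 r (E * w)) ^ 2) =
    (\<Sum>i<r. \<Sum>j<r. E ^ 3 ^ i * E ^ 3 ^ j * M (a + 3 ^ i + 3 ^ j))"
  proof -
    have "(\<Sum>w\<in>UNIV. \<phi> w * w ^ a * (trace3 r (E * w)) ^ 2) =
      (\<Sum>w\<in>UNIV. \<Sum>i<r. \<Sum>j<r. E ^ 3 ^ i * E ^ 3 ^ j * (\<phi> w * w ^ (a + 3 ^ i + 3 ^ j)))"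
      unfolding trace3_def power2_eq_square sum_product
      by (simp add: sum_distrib_left power_mult_distrib power_add mult_ac)
    also have "\<dots> = (\<Sum>i<r. \<Sum>w\<in>UNIV. \<Sum>j<r. E ^ 3 ^ i * E ^ 3 ^ j * (\<phi> w * w ^ (a + 3 ^ i + 3 ^ j)))"
      by (rule sum.swap)
    also have "\<dots> = (\<Sum>i<r. \<Sum>j<r. \<Sum>w\<in>UNIV. E ^ 3 ^ i * E ^ 3 ^ j * (\<phi> w * w ^ (a + 3 ^ i + 3 ^ j)))"
      by (intro sum.cong refl sum.swap)
    finally show ?thesis by (simp add: M_def sum_distrib_left)
  qed
  have "(\<Sum>w\<in>UNIV. \<phi> w * w ^ a * ((trace3 r (E * w) - t) ^ 2 - 1)) =
    (\<Sum>w\<in>UNIV. \<phi> w * w ^ a * (trace3 r (E * w)) ^ 2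
      - 2 * t * (\<phi> w * w ^ a * trace3 r (E * w)) + (t ^ 2 - 1) * (\<phi> w * w ^ a))"
    by (intro sum.cong refl) (simp add: power2_eq_square algebra_simps)
  also have "\<dots> = (\<Sum>w\<in>UNIV. \<phi> w * w ^ a * (trace3 r (E * w)) ^ 2)
      - 2 * t * (\<Sum>w\<in>UNIV. \<phi> w * w ^ a * trace3 r (E * w)) + (t ^ 2 - 1) * M a"
    by (simp only: sum.distrib sum_subtractf sum_distrib_left[symmetric] M_def)
  finally show ?thesis unfolding 1 2 .
qed

text \<open>The vanishing function \<open>(\<eta> w ^ 2 + \<eta> w) * Q w\<close> is summed against
  \<open>w ^ a\<close>. Here \<open>\<eta> w ^ 2\<close> is 1 except at 0 and -1: the constant 1
  contributes nothing, the point 0 is killed by \<open>a > 0\<close>, and -1 yields the right-hand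
  side. The upper bound on \<open>a\<close> keeps every exponent below
  \<open>CARD('a) - 1\<close>.\<close>

lemma trace_identity:
  fixes E t :: "'a::{field,finite}"
  defines "g \<equiv> \<lambda>n. of_bool (zero_one_ternary n)"
  assumes q: "CARD('a) = 3 ^ r" and a: "0 < a" "a + 2 * 3 ^ (r - 1) < 3 ^ r - 1"
    and H: "\<And>w c. c \<noteq> 0 \<Longrightarrow> w ^ 2 + w = c ^ 2 \<Longrightarrow> (trace3 r (E * w) - t) ^ 2 = 1"
  shows "(\<Sum>i<r. \<Sum>j<r. E ^ 3 ^ i * E ^ 3 ^ j * g (a + 3 ^ i + 3 ^ j))
    - 2 * t * (\<Sum>i<r. E ^ 3 ^ i * g (a + 3 ^ i)) + (t ^ 2 - 1) * g a
    = - ((-1) ^ a * ((trace3 r E + t) ^ 2 - 1))" (is "?X = _")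
proof -
  define m where "m = ((3::nat) ^ r - 1) div 2"
  define \<eta> where "\<eta> = (\<lambda>w::'a. (w ^ 2 + w) ^ m)"
  define Q where "Q = (\<lambda>w. (trace3 r (E * w) - t) ^ 2 - 1)"
  have m: "CARD('a) = 2 * m + 1" by (simp add: m_def q)
  have le: "(3::nat) ^ i \<le> 3 ^ (r - 1)" if "i < r" for i
    using that by (intro power_increasing) auto
  have b: "a + 3 ^ i + 3 ^ j < 3 ^ r - 1" if "i < r" "j < r" for i j
    using le[OF that(1)] le[OF that(2)] a(2) by linarith
  have b': "a + 3 ^ i < 3 ^ r - 1" if "i < r" for i
    using le[OF that] a(2) by linarith
  have "a < 3 ^ r - 1" using a(2) by linarith
  have S: "(\<Sum>w\<in>UNIV. 1 * (w::'a) ^ n) = 0" if "0 < n" "n < 3 ^ r - 1" for n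
    using that q nat_dvd_not_less[of n "3 ^ r - 1"] by (simp add: finite_field_sum_powers)
  have "(\<Sum>w\<in>UNIV. 1 * w ^ a * Q w) = 0"
    unfolding Q_def sum_weighted_trace_square
    using a(1) b b' S[OF a(1) \<open>a < 3 ^ r - 1\<close>] by (simp add: S[simplified])
  have sq: "\<eta> w ^ 2 = 1 - of_bool (w = 0) - of_bool (w = -1)" for w
  proof -
    have "w ^ 2 + w = w * (w + 1)" by (simp add: power2_eq_square algebra_simps)
    then have "w ^ 2 + w = 0 \<longleftrightarrow> w = 0 \<or> w = -1" by (simp add: eq_neg_iff_add_eq_0)
    moreover have "\<eta> w ^ 2 = (w ^ 2 + w) ^ (CARD('a) - 1)"
      by (simp add: \<eta>_def m mult.commute flip: power_mult)
    moreover have "CARD('a) - 1 > 0" using \<open>a < _\<close> q by simp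
    ultimately show ?thesis
      using finite_field_power_card_minus_1[of "w ^ 2 + w"]
      by (cases "w ^ 2 + w = 0") auto
  qed
  \<comment> \<open>The values of \<open>\<eta>\<close> are 0, 1 and -1. The first factor vanishes
    at 0 and -1, while \<open>\<eta> w = 1\<close> makes \<open>w ^ 2 + w\<close> a nonzero square,
    so \<open>H\<close> applies.\<close>
  have "(\<eta> w ^ 2 + \<eta> w) * Q w = 0" for w
  proof -
    have "\<eta> w ^ 3 = \<eta> w"
      using sq[of w] by (auto simp: power3_eq_cube power2_eq_square \<eta>_def)
    then have "(\<eta> w ^ 2 + \<eta> w) * (\<eta> w - 1) = 0"
      by (simp add: power3_eq_cube power2_eq_square algebra_simps)
    moreover have "Q w = 0" if w: "\<eta> w = 1"
    proof -
      obtain c where "c \<noteq> 0" "w ^ 2 + w = c ^ 2"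
        using finite_field_square_if_power_eq_1[OF m, of "w ^ 2 + w"] w by (auto simp: \<eta>_def)
      then show ?thesis using H by (simp add: Q_def)
    qed
    ultimately show ?thesis by auto
  qed
  then have "0 = (\<Sum>w\<in>UNIV. (\<eta> w ^ 2 + \<eta> w) * Q w * w ^ a)"
    by (simp only: mult_zero_left sum.neutral_const)
  also have "\<dots> = (\<Sum>w\<in>UNIV. 1 * w ^ a * Q w - of_bool (w = 0) * (w ^ a * Q w)
      - of_bool (w = -1) * (w ^ a * Q w) + \<eta> w * w ^ a * Q w)"
    unfolding sq by (intro sum.cong refl) (simp add: algebra_simps)
  also have "\<dots> = - ((-1) ^ a * Q (-1)) + (\<Sum>w\<in>UNIV. \<eta> w * w ^ a * Q w)"
    unfolding sum.distrib sum_subtractf \<open>(\<Sum>w\<in>UNIV. 1 * w ^ a * Q w) = 0\<close> using a(1) by simp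
  also have "Q (-1) = (trace3 r E + t) ^ 2 - 1"
    by (simp add: Q_def trace3_minus power2_eq_square algebra_simps)
  also have "(\<Sum>w\<in>UNIV. \<eta> w * w ^ a * Q w) = - ?X"
  proof -
    have M: "(\<Sum>w\<in>UNIV. \<eta> w * w ^ n) = - g n" if "n < 3 ^ r - 1" for n
      unfolding \<eta>_def g_def by (rule sum_powers_quadratic_character[OF q m_def that])
    have "(\<Sum>i<r. \<Sum>j<r. E ^ 3 ^ i * E ^ 3 ^ j * (\<Sum>w\<in>UNIV. \<eta> w * w ^ (a + 3 ^ i + 3 ^ j))) =
      (\<Sum>i<r. \<Sum>j<r. - (E ^ 3 ^ i * E ^ 3 ^ j * g (a + 3 ^ i + 3 ^ j)))"
      by (intro sum.cong refl) (simp only: M b lessThan_iff mult_minus_right)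
    moreover have "(\<Sum>i<r. E ^ 3 ^ i * (\<Sum>w\<in>UNIV. \<eta> w * w ^ (a + 3 ^ i))) =
      (\<Sum>i<r. - (E ^ 3 ^ i * g (a + 3 ^ i)))"
      by (intro sum.cong refl) (simp only: M b' lessThan_iff mult_minus_right)
    ultimately show ?thesis
      unfolding Q_def sum_weighted_trace_square M[OF \<open>a < _\<close>] by (simp only: sum_negf) simp
  qed
  finally show ?thesis by (simp add: algebra_simps)
qed

lemma no_trace_avoidance:
  fixes E t :: "'a::{field,finite}"
  assumes q: "CARD('a) = 3 ^ r" and r: "r > 2" and "E \<noteq> 0" and t: "t ^ 3 = t"
    and H: "\<And>w c. c \<noteq> 0 \<Longrightarrow> w ^ 2 + w = c ^ 2 \<Longrightarrow> (trace3 r (E * w) - t) ^ 2 = 1"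
  shows False
proof -
  define g where "g = (\<lambda>n. of_bool (zero_one_ternary n) :: 'a)"
  define s where "s = (\<lambda>P. \<Sum>i<r. E ^ 3 ^ i * of_bool (P i))"
  define \<tau> where "\<tau> = trace3 r E"
  define D where "D = (\<tau> + t) ^ 2 - 1"
  note c3 = card_3_power_imp_char3[OF q]
  have two: "(2::'a) = -1" using c3 by (simp add: eq_neg_iff_add_eq_0)
  obtain k where k: "r = Suc (Suc (Suc k))"
    using r by (metis Suc_diff_Suc add_2_eq_Suc less_imp_Suc_add plus_1_eq_Suc)
  have prod: "(\<Sum>i<r. \<Sum>j<r. E ^ 3 ^ i * E ^ 3 ^ j * (of_bool (P i) * of_bool (R j))) = s P * s R" for P R
    by (simp only: s_def sum_product) (intro sum.cong refl, simp add: mult_ac)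
  have single: "s (\<lambda>i. i = p) = E ^ 3 ^ p" if "p < r" for p
    using that by (simp add: s_def if_distrib of_bool_def cong: if_cong)
  have s01: "s (\<lambda>i. i = 0) = E" "s (\<lambda>i. i = 1) = E ^ 3" "s (\<lambda>i. i = 2) = E ^ 9"
    using r by (simp_all add: single)
  have s2: "s (\<lambda>i. 2 \<le> i) = \<tau> - E - E ^ 3"
  proof -
    have "\<tau> = (\<Sum>i<r. E ^ 3 ^ i * (of_bool (i = 0) + of_bool (i = 1) + of_bool (2 \<le> i)))"
      unfolding \<tau>_def trace3_def by (intro sum.cong refl) auto
    also have "\<dots> = s (\<lambda>i. i = 0) + s (\<lambda>i. i = 1) + s (\<lambda>i. 2 \<le> i)"
      by (simp only: s_def distrib_left sum.distrib)
    finally show ?thesis unfolding s01 by simp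
  qed
  \<comment> \<open>With \<open>N = 3 ^ (r - 2)\<close> the range condition on the order
    \<open>a\<close> reads \<open>a < 3 * N - 1\<close>. Orders 5 and 2 need
    \<open>N \<ge> 3\<close>; order 20 needs \<open>N \<ge> 9\<close>, that is
    \<open>r > 3\<close>.\<close>
  have pow: "(3::nat) ^ r = 9 * 3 ^ (r - 2)" "(3::nat) ^ (r - 1) = 3 * 3 ^ (r - 2)" by (simp_all add: k)
  have "(3::nat) ^ (r - 2) \<ge> 3 ^ 1" using r by (intro power_increasing) auto
  then have "(3::nat) ^ (r - 2) \<ge> 3" by simp
  then have le: "5 + 2 * 3 ^ (r - 1) < 3 ^ r - (1::nat)" "2 + 2 * 3 ^ (r - 1) < 3 ^ r - (1::nat)"
    unfolding pow by linarith+
  have g5: "g (5 + 3 ^ i + 3 ^ j) =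
    of_bool (i = 0) * of_bool (j = 1) + of_bool (i = 1) * of_bool (j = 0)" "g (5 + 3 ^ i) = 0" "g 5 = 0" for i j
    by (auto simp: g_def zero_one_ternary_5_plus zero_one_ternary_numeral)
  have digits: "(\<Sum>i<r. \<Sum>j<r. E ^ 3 ^ i * E ^ 3 ^ j * g (a + 3 ^ i + 3 ^ j))
    - 2 * t * (\<Sum>i<r. E ^ 3 ^ i * g (a + 3 ^ i)) + (t ^ 2 - 1) * g a = - ((-1) ^ a * D)"
    if "0 < a" "a + 2 * 3 ^ (r - 1) < 3 ^ r - 1" for a
    unfolding g_def D_def \<tau>_def by (rule trace_identity[OF q that H])
  have eq5: "2 * E ^ 4 = D"
  proof -
    have "E * E ^ 3 + E ^ 3 * E = D"
      using digits[OF _ le(1)] unfolding g5 distrib_left sum.distrib prod s01 by simp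
    then show ?thesis by (simp add: eval_nat_numeral mult_ac)
  qed
  have g2: "g (2 + 3 ^ i + 3 ^ j) = of_bool (i = 0) * of_bool (j = 0)
      + of_bool (i = 0) * of_bool (2 \<le> j) + of_bool (2 \<le> i) * of_bool (j = 0)"
    "g (2 + 3 ^ i) = of_bool (i = 0)" "g 2 = 0" for i j
    unfolding g_def zero_one_ternary_2_plus by (auto simp: zero_one_ternary_numeral)
  have eq2: "E * E + E * (\<tau> - E - E ^ 3) + (\<tau> - E - E ^ 3) * E - 2 * t * E = - D"
    using digits[OF _ le(2)] s01(1)[unfolded s_def]
    unfolding g2 distrib_left sum.distrib prod s01 s2 by simp
  have \<tau>: "\<tau> ^ 3 = \<tau>" unfolding \<tau>_def by (rule trace3_cube(1)[OF q])
  \<comment> \<open>An element fixed by cubing is 0 or has square 1; the latter would give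
    \<open>D = 0\<close>, against \<open>eq5\<close>.\<close>
  have "(\<tau> + t) ^ 3 = \<tau> + t" by (simp add: char3_cube_add[OF c3] \<tau> t)
  then have "(\<tau> + t) * D = 0" by (simp add: D_def power2_eq_square power3_eq_cube algebra_simps)
  moreover have "D \<noteq> 0" using eq5 \<open>E \<noteq> 0\<close> two by auto
  ultimately have t\<tau>: "t = - \<tau>" by (simp add: eq_neg_iff_add_eq_0 add.commute)
  then have D: "D = -1" by (simp add: D_def)
  have E4: "E ^ 4 = 1" using eq5 unfolding D two by simp
  have "E * E + 2 * E * (\<tau> - E) - 2 * E ^ 4 - 2 * t * E = 1"
    using eq2 unfolding D by (simp add: algebra_simps eval_nat_numeral)
  then have "E * (\<tau> - E) = 0"
    unfolding E4 two t\<tau> using two by (auto simp: algebra_simps)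
  then have E\<tau>: "\<tau> = E" using \<open>E \<noteq> 0\<close> by simp
  have "E * (E ^ 2 - 1) = 0"
    using \<tau> unfolding E\<tau> by (simp add: algebra_simps power2_eq_square power3_eq_cube)
  then have E2: "E ^ 2 = 1" using \<open>E \<noteq> 0\<close> by simp
  show False
  \<comment> \<open>For \<open>r = 3\<close> the trace of \<open>E\<close> is explicitly
    \<open>E + E ^ 3 + E ^ 9 = 3 * E = 0\<close>. For larger \<open>r\<close>, order 20 gives
    \<open>2 * E ^ 10 = - D = 1\<close>, although \<open>2 = -1\<close>: the even order flips the
    sign found at order 5.\<close>
  proof (cases "r = 3")
    case True
    have "E ^ 9 = (E ^ 2) ^ 4 * E" "E ^ 3 = E ^ 2 * E"
      by (simp_all add: eval_nat_numeral)
    then have "E ^ 9 = E" "E ^ 3 = E" using E2 by simp_all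
    moreover have "\<tau> = E + E ^ 3 + E ^ 9"
      by (simp add: \<tau>_def trace3_def True lessThan_nat_numeral add_ac)
    ultimately have "E = 3 * E" using E\<tau> by simp
    then show False using c3 \<open>E \<noteq> 0\<close> by simp
  next
    case False
    then have "(3::nat) ^ (r - 2) \<ge> 3 ^ 2" using r by (intro power_increasing) auto
    then have "(3::nat) ^ (r - 2) \<ge> 9" by simp
    then have le20: "20 + 2 * 3 ^ (r - 1) < 3 ^ r - (1::nat)"
      unfolding pow by linarith
    have g20: "g (20 + 3 ^ i + 3 ^ j) =
      of_bool (i = 0) * of_bool (j = 2) + of_bool (i = 2) * of_bool (j = 0)" "g (20 + 3 ^ i) = 0" "g 20 = 0" for i j
      by (auto simp: g_def zero_one_ternary_20_plus zero_one_ternary_numeral)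
    have "E * E ^ 9 + E ^ 9 * E = - D"
      using digits[OF _ le20] unfolding g20 distrib_left sum.distrib prod s01 by simp
    then have "2 * (E ^ 2) ^ 5 = - D" by (simp add: eval_nat_numeral mult_ac)
    then have "(3::'a) = 2" using E2 D c3 two by simp
    then show False using c3 two by simp
  qed
qed

subsection \<open>Reduction of the sextic to the trace condition\<close>

text \<open>The missing term of degree 5 leaves a gap of two below the leading term, and the gap
  persists in powers. Cubing widens it to six, which is what \<open>hermite_condition\<close>
  needs.\<close>

lemma power_eq_monom_plus_low_degree:
  fixes f :: "'a::comm_ring_1 poly"
  assumes "f = monom 1 6 + l" "degree l \<le> 4"
  shows "\<exists>h. f ^ K = monom 1 (6 * K) + h \<and> (K > 0 \<longrightarrow> degree h + 2 \<le> 6 * K) \<and> (K = 0 \<longrightarrow> h = 0)"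
proof (induction K)
  case 0
  then show ?case by (simp add: monom_0)
next
  case (Suc K)
  then obtain h where h: "f ^ K = monom 1 (6 * K) + h" "K > 0 \<longrightarrow> degree h + 2 \<le> 6 * K" "K = 0 \<longrightarrow> h = 0"
    by blast
  have df: "degree f \<le> 6"
    unfolding assms(1) by (rule degree_add_le) (use assms(2) in \<open>auto intro: degree_monom_le[THEN order_trans]\<close>)
  have "f ^ Suc K = monom 1 (6 * Suc K) + (l * monom 1 (6 * K) + f * h)"
    unfolding power_Suc h(1) distrib_left[of f] by (simp add: assms(1) algebra_simps mult_monom)
  moreover have "degree (l * monom 1 (6 * K) + f * h) \<le> 6 * K + 4"
  proof (rule degree_add_le)
    have "degree (l * monom 1 (6 * K)) \<le> degree l + degree (monom (1::'a) (6 * K))"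
      by (rule degree_mult_le)
    then show "degree (l * monom 1 (6 * K)) \<le> 6 * K + 4"
      using assms(2) degree_monom_le[of "1::'a" "6 * K"] by linarith
    show "degree (f * h) \<le> 6 * K + 4"
      using degree_mult_le[of f h] df h(2,3) by (cases "K = 0") auto
  qed
  ultimately show ?case by (intro exI[of _ "l * monom 1 (6 * K) + f * h"]) simp
qed

text \<open>The exponent is \<open>2 + 3 * K\<close> with \<open>CARD('a) = 18 * K + 9\<close>.
  Writing the power as \<open>f ^ 2 * (f ^ K) ^ 3\<close>, the lower part of the cube is too small
  in degree to reach \<open>18 * K + 8\<close>, so the critical coefficient is that of degree 8 in
  \<open>f ^ 2\<close>.\<close>

lemma hermite_condition:
  fixes f :: "'a::{field,finite} poly"
  assumes q: "CARD('a) = 3 ^ r" and "r > 2"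
    and f: "f = monom 1 6 + monom a4 4 + monom a3 3 + monom a2 2 + monom a1 1"
    and "bij (poly f)"
  shows "a2 = a4 ^ 2"
proof -
  note c3 = card_3_power_imp_char3[OF q]
  have c3': "(3::'a poly) = 0" using c3 by (simp add: numeral_poly)
  have "odd ((3::nat) ^ (r - 2))" by simp
  then obtain K :: nat where K: "3 ^ (r - 2) = 2 * K + 1" by (elim oddE)
  have "(3::nat) ^ r = 9 * 3 ^ (r - 2)"
    using power_add[of "3::nat" 2 "r - 2"] \<open>r > 2\<close> by (simp only: le_add_diff_inverse less_imp_le) simp
  then have qK: "CARD('a) = 18 * K + 9" using q K by simp
  have "(3::nat) ^ (r - 2) \<ge> 3 ^ 1" using \<open>r > 2\<close> by (intro power_increasing) auto
  then have "K > 0" using K by simp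
  define l where "l = monom a4 4 + monom a3 3 + monom a2 2 + monom a1 1"
  have fl: "f = monom 1 6 + l" by (simp add: f l_def)
  have dl: "degree l \<le> 4"
    unfolding l_def by (intro degree_add_le) (auto intro: degree_monom_le[THEN order_trans])
  have df: "degree f \<le> 6"
    unfolding fl by (rule degree_add_le) (use dl in \<open>auto intro: degree_monom_le[THEN order_trans]\<close>)
  obtain h where h: "f ^ K = monom 1 (6 * K) + h" "degree h + 2 \<le> 6 * K"
    using power_eq_monom_plus_low_degree[OF fl dl, of K] \<open>K > 0\<close> by blast
  have "f ^ (2 + 3 * K) = f ^ 2 * (f ^ K) ^ 3" 
    by (simp only: power_add mult.commute[of 3] power_mult)
  also have "\<dots> = f ^ 2 * monom 1 (18 * K) + f ^ 2 * h ^ 3"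
    unfolding h(1) char3_cube_add[OF c3'] by (simp add: monom_power distrib_left)
  finally have fN: "f ^ (2 + 3 * K) = f ^ 2 * monom 1 (18 * K) + f ^ 2 * h ^ 3" .
  have d2: "degree (f ^ 2) \<le> 12" using degree_power_le[of f 2] df by linarith
  have "degree (f ^ 2 * h ^ 3) < 18 * K + 8"
    using degree_mult_le[of "f ^ 2" "h ^ 3"] degree_power_le[of h 3] d2 h(2) by linarith
  moreover have "coeff (f ^ 2 * monom 1 (18 * K)) (18 * K + 8) = coeff (f ^ 2) 8"
    by (subst mult.commute) (simp add: coeff_monom_mult)
  ultimately have "coeff (f ^ (2 + 3 * K)) (18 * K + 8) = coeff (f ^ 2) 8"
    unfolding fN by (simp add: coeff_eq_0)
  also have "\<dots> = 2 * a2 + a4 ^ 2"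
  proof -
    have "coeff f 0 = 0" "coeff f 1 = a1" "coeff f 2 = a2" "coeff f 3 = a3" "coeff f 4 = a4"
      "coeff f 5 = 0" "coeff f 6 = 1" "coeff f 7 = 0" "coeff f 8 = 0"
      by (simp_all add: f)
    then show ?thesis
      unfolding power2_eq_square coeff_mult by (simp add: atMost_nat_numeral)
  qed
  also have "18 * K + 8 = CARD('a) - 1" using qK by simp
  finally have c: "coeff (f ^ (2 + 3 * K)) (CARD('a) - 1) = 2 * a2 + a4 ^ 2" .
  have dN: "degree (f ^ (2 + 3 * K)) < 2 * (CARD('a) - 1)"
    using degree_power_le[of f "2 + 3 * K", THEN order_trans, OF mult_le_mono1[OF df]] qK by simp
  have "(\<Sum>x\<in>UNIV. poly (f ^ (2 + 3 * K)) x) = (\<Sum>y\<in>UNIV. y ^ (2 + 3 * K))"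
    unfolding poly_power using \<open>bij (poly f)\<close>
    by (intro sum.reindex_bij_betw[of "poly f" UNIV UNIV "\<lambda>y. y ^ (2 + 3 * K)"])
  also have "\<dots> = 0"
    using nat_dvd_not_less[of "2 + 3 * K" "CARD('a) - 1"] qK
    unfolding finite_field_sum_powers by simp
  finally have "2 * a2 + a4 ^ 2 = 0"
    using finite_field_sum_poly[OF dN] c by simp
  then have "3 * a2 = a2 - a4 ^ 2" by (simp add: algebra_simps)
  then show ?thesis using c3 by simp
qed

lemma inj_sextic_imp_trace_condition:
  fixes a b d :: "'a::{field,finite}"
  assumes q: "CARD('a) = 3 ^ r" and r: "r > 2"
    and inj: "inj (\<lambda>x. x ^ 6 + a * x ^ 4 + b * x ^ 3 + a ^ 2 * x ^ 2 + d * x)"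
  shows "\<exists>E B :: 'a. E \<noteq> 0 \<and> (\<forall>z. z ^ 3 \<noteq> z \<longrightarrow> trace3 r (B + E * (z / (z ^ 3 - z))) \<noteq> 0)"
proof -
  note c3 = card_3_power_imp_char3[OF q]
  have two: "(2::'a) = -1" using c3 by (simp add: eq_neg_iff_add_eq_0)
  define L where "L = (\<lambda>x. x ^ 3 - a * x)"
  define e where "e = d + a * b"
  define f where "f = (\<lambda>x. x ^ 6 + a * x ^ 4 + b * x ^ 3 + a ^ 2 * x ^ 2 + d * x)"
  have L_add: "L (x + y) = L x + L y" for x y
    by (simp add: L_def char3_cube_add[OF c3] algebra_simps)
  have f: "f x = L x ^ 2 + b * L x + e * x" for x
  proof -
    have "L x ^ 2 + b * L x + e * x = f x - 3 * a * x ^ 4"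
      by (simp add: L_def f_def e_def eval_nat_numeral algebra_simps)
    then show ?thesis using c3 by simp
  qed
  have diff: "f (y + u) - f y = L u * (L u + b - L y) + e * u" for y u
  proof -
    have "f (y + u) - f y = L u * (L u + b - L y) + e * u + 3 * (L u * L y)"
      unfolding f L_add by (simp add: power2_eq_square algebra_simps)
    then show ?thesis using c3 by simp
  qed
  have ne: "L u * (L u + b - L y) + e * u \<noteq> 0" if "u \<noteq> 0" for u y
    unfolding diff[symmetric] using that injD[OF inj, of "y + u" y] by (auto simp: f_def)
  have "\<exists>s. s \<noteq> 0 \<and> L s = 0"
  proof (rule ccontr)
    assume no: "\<not> ?thesis"
    have "inj L"
    proof (rule injI)
      fix x y assume "L x = L y"
      then have "L (x - y) = 0" using L_add[of "x - y" y] by simp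
      then have "x - y = 0" using no by blast
      then show "x = y" by simp
    qed
    then have "surj L" using finite_UNIV_inj_surj[OF finite] by blast
    \<comment> \<open>This \<open>y\<close> solves \<open>f (y + 1) = f y\<close>, the equation
      \<open>ne\<close> forbids.\<close>
    then obtain y where "L y = L 1 + b + e / L 1" by (metis surjD)
    moreover have "L 1 \<noteq> 0" using no zero_neq_one by metis
    ultimately show False using ne[of 1 y] by (simp add: field_simps)
  qed
  then obtain s where s: "s \<noteq> 0" "L s = 0" by blast
  have "s * (s ^ 2 - a) = 0"
    using s(2) by (simp add: L_def power2_eq_square power3_eq_cube algebra_simps)
  then have a: "a = s ^ 2" using s(1) by simp
  have Ls: "L (s * z) = s ^ 3 * (z ^ 3 - z)" for z
    by (simp add: L_def a power_mult_distrib power2_eq_square power3_eq_cube algebra_simps)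
  have "e \<noteq> 0" using ne[OF s(1)] s by simp
  have tr: "trace3 r (b / s ^ 3 + e / s ^ 5 * (z / (z ^ 3 - z))) \<noteq> 0" if z: "z ^ 3 \<noteq> z" for z
  proof
    assume "trace3 r (b / s ^ 3 + e / s ^ 5 * (z / (z ^ 3 - z))) = 0"
    then obtain y where y: "y ^ 3 - y = b / s ^ 3 + e / s ^ 5 * (z / (z ^ 3 - z))"
      using trace3_eq_0_imp[OF q] r by auto
    define Z where "Z = z ^ 3 - z"
    have "Z \<noteq> 0" "z \<noteq> 0" using z by (auto simp: Z_def)
    \<comment> \<open>For the increment \<open>s * z\<close>, the base point
      \<open>s * (z + y)\<close> is chosen so that its summand \<open>s ^ 3 * Z\<close> cancels
      \<open>L (s * z)\<close>; what remains vanishes by the equation for \<open>y\<close>.\<close>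
    have L1: "L (s * (z + y)) = s ^ 3 * (Z + (y ^ 3 - y))"
      unfolding Ls by (simp add: Z_def char3_cube_add[OF c3] algebra_simps)
    have "s ^ 3 * Z * (s ^ 3 * Z + b - s ^ 3 * (Z + (y ^ 3 - y))) + e * (s * z) = 0"
    proof -
      have "s ^ 3 * (b / s ^ 3) = b" "s ^ 3 * Z * (s ^ 3 * (e / s ^ 5 * (z / Z))) = e * (s * z)"
        using \<open>Z \<noteq> 0\<close> s(1) by (simp_all add: eval_nat_numeral)
      then show ?thesis unfolding y Z_def[symmetric] by (simp add: distrib_left right_diff_distrib)
    qed
    then show False using ne[of "s * z" "s * (z + y)"] \<open>z \<noteq> 0\<close> s(1) unfolding L1
      by (simp add: Ls Z_def)
  qed
  have "e / s ^ 5 \<noteq> 0" using \<open>e \<noteq> 0\<close> s(1) by simp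
  show ?thesis
    by (rule exI[of _ "e / s ^ 5"], rule exI[of _ "b / s ^ 3"]) (use tr \<open>e / s ^ 5 \<noteq> 0\<close> in auto)
qed

theorem theorem3p15:
  fixes r :: nat
  assumes "r > 2"
    and "CARD('a :: {field, finite}) = 3 ^ r"
  shows "\<not> (\<exists>(f :: 'a poly) a1 a2 a3 a4.
            f = monom 1 6 + monom a4 4 + monom a3 3 + monom a2 2 + monom a1 1 \<and>
            permutation_polynomial f)"
proof (intro notI; elim exE conjE)
  fix f :: "'a poly" and a1 a2 a3 a4
  assume f: "f = monom 1 6 + monom a4 4 + monom a3 3 + monom a2 2 + monom a1 1"
    and "permutation_polynomial f"
  then have bij: "bij (poly f)" by (simp add: permutation_polynomial_def)
  note q = assms(2) and c3 = card_3_power_imp_char3[OF assms(2)]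
  have "a2 = a4 ^ 2" by (rule hermite_condition[OF q assms(1) f bij])
  then have "poly f = (\<lambda>x. x ^ 6 + a4 * x ^ 4 + a3 * x ^ 3 + a4 ^ 2 * x ^ 2 + a1 * x)"
    by (simp add: f poly_monom fun_eq_iff)
  with bij have "inj (\<lambda>x. x ^ 6 + a4 * x ^ 4 + a3 * x ^ 3 + a4 ^ 2 * x ^ 2 + a1 * x)"
    by (simp add: bij_def)
  from inj_sextic_imp_trace_condition[OF q assms(1) this]
  obtain E B :: 'a where E: "E \<noteq> 0"
    and tr: "\<And>z. z ^ 3 \<noteq> z \<Longrightarrow> trace3 r (B + E * (z / (z ^ 3 - z))) \<noteq> 0"
    by blast
  have H: "(trace3 r (E * w) - - trace3 r B) ^ 2 = 1" if c: "c \<noteq> 0" "w ^ 2 + w = c ^ 2" for w c :: 'a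
  proof -
    \<comment> \<open>This inverts \<open>w = 1 / (z ^ 2 - 1)\<close>: from
      \<open>w ^ 2 + w = c ^ 2\<close> one gets \<open>z ^ 2 = 1 + 1 / w\<close>.\<close>
    define z where "z = c / w"
    have "w \<noteq> 0" "z \<noteq> 0" using c by (auto simp: z_def)
    then have z2: "z ^ 2 - 1 = 1 / w"
      unfolding z_def power_divide c(2)[symmetric] by (simp add: field_simps power2_eq_square)
    have z3: "z ^ 3 - z = z * (z ^ 2 - 1)"
      by (simp add: power2_eq_square power3_eq_cube algebra_simps)
    have "z ^ 3 - z \<noteq> 0" unfolding z3 z2 using \<open>z \<noteq> 0\<close> \<open>w \<noteq> 0\<close> by simp
    moreover have "z / (z ^ 3 - z) = w" unfolding z3 z2 using \<open>z \<noteq> 0\<close> \<open>w \<noteq> 0\<close> by simp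
    ultimately have "trace3 r (B + E * w) \<noteq> 0" using tr[of z] by auto
    moreover have "trace3 r (B + E * w) * (trace3 r (B + E * w) ^ 2 - 1) = 0"
      using trace3_cube(1)[OF q, of "B + E * w"]
      by (simp add: power2_eq_square power3_eq_cube algebra_simps)
    ultimately have "trace3 r (B + E * w) ^ 2 = 1" by simp
    then show ?thesis by (simp add: trace3_add[OF c3] add.commute)
  qed
  have "(- trace3 r B) ^ 3 = - trace3 r B"
    using trace3_cube(1)[OF q, of B] by simp
  from no_trace_avoidance[OF q assms(1) E this H] show False .
qed

end
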